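(* Let $(\mathrm{i},\mathrm{e})$ be a Galois connection on a pair of (finite) lattices $(X,L)$, and let $F$ be a subconfluence of $L$ with associated interior operators $\{p_t\}_{t\in F}$. For $t\in F$ let $h_t=\mathrm{e}\circ p_t\circ \mathrm{i}$ on $X_{\mathrm{e}(t)}$. Then $$\mathrm{e}[F]=\bigcup_{t\in F} h_t[X_{\mathrm{e}(t)}]=\bigcup_{m\in \min(F)} h_m[X_{\mathrm{e}(m)}],$$ where $\min(F)$ is the set of minimal elements of $F$.
   Context: All ordered sets are finite. For an ordered set $E$ and $t\in E$: $E^t=\{x\in E: x\ge t\}$, $E_t=\{x\in E: x\le t\}$. A (finite) ordered set $F$ is a confluence if for every $t\in F$, $F^t$ is a meet-semilattice with a greatest element (hence, by finiteness, a lattice). A subset $F$ of a lattice $L$ is a subconfluence of $L$ if, with the induced order, $F$ is a confluence and for all $t\in F$ and $x,y\in F^t$ the join of $x,y$ in $F^t$ equals their join $x\vee y$ in $L$. For $t\in F$ the associated interior operator $p_t:L^t\to L^t$ is $p_t(x)=\bigvee_{q\in F^t\cap L_x} q$ (join in $L$); it has range $F^t$. A Galois connection on $(X,L)$ is a pair of maps $\mathrm{i}:X\to L$, $\mathrm{e}:L\to X$, both order-reversing, with $\mathrm{e}\circ\mathrm{i}(x)\ge x$ for all $x\in X$ and $\mathrm{i}\circ\mathrm{e}(l)\ge l$ for all $l\in L$. For $x\in X_{\mathrm{e}(t)}$ one has $\mathrm{i}(x)\in L^t$, so $h_t$ is well defined on $X_{\mathrm{e}(t)}$. *)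

theory Defs
  imports Main "HOL-Library.Lub_Glb"
begin

text \<open>
  In an ordered set \<open>F\<close>, the sets \<open>F\<^sup>t\<close> and \<open>F\<^sub>t\<close> are \<open>F \<inter> {t..}\<close> and \<open>F \<inter> {..t}\<close>.  Infima and
  suprema computed inside a subset \<open>A\<close> with the induced order are expressed by \<^const>\<open>isGlb\<close> and
  \<^const>\<open>isLub\<close> with carrier \<open>A\<close>.
\<close>

definition is_meet_semilattice :: "'a::order set \<Rightarrow> bool" where
  "is_meet_semilattice A \<longleftrightarrow> (\<forall>x\<in>A. \<forall>y\<in>A. \<exists>z. isGlb A {x, y} z)"

definition has_greatest :: "'a::order set \<Rightarrow> bool" where
  "has_greatest A \<longleftrightarrow> (\<exists>g\<in>A. \<forall>x\<in>A. x \<le> g)"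

definition confluence :: "'a::order set \<Rightarrow> bool" where
  "confluence F \<longleftrightarrow> finite F \<and>
    (\<forall>t\<in>F. is_meet_semilattice (F \<inter> {t..}) \<and> has_greatest (F \<inter> {t..}))"

definition subconfluence :: "'a::lattice set \<Rightarrow> bool" where
  "subconfluence F \<longleftrightarrow> confluence F \<and>
    (\<forall>t\<in>F. \<forall>x\<in>F \<inter> {t..}. \<forall>y\<in>F \<inter> {t..}. isLub (F \<inter> {t..}) {x, y} (sup x y))"

text \<open>
  Only meaningful for \<open>t \<in> F\<close> and \<open>x \<ge> t\<close> in a finite lattice: the joined set then contains \<open>t\<close>,
  so the join is over a finite nonempty set.
\<close>

definition interior_op :: "'a::lattice set \<Rightarrow> 'a \<Rightarrow> 'a \<Rightarrow> 'a" where
  "interior_op F t x = \<Squnion>\<^sub>f\<^sub>i\<^sub>n ((F \<inter> {t..}) \<inter> {..x})"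

definition galois_connection :: "('x::order \<Rightarrow> 'l::order) \<Rightarrow> ('l \<Rightarrow> 'x) \<Rightarrow> bool" where
  "galois_connection i e \<longleftrightarrow> antimono i \<and> antimono e \<and> (\<forall>x. x \<le> e (i x)) \<and> (\<forall>l. l \<le> i (e l))"

definition h_op :: "('x \<Rightarrow> 'l) \<Rightarrow> ('l \<Rightarrow> 'x) \<Rightarrow> 'l::lattice set \<Rightarrow> 'l \<Rightarrow> 'x \<Rightarrow> 'x" where
  "h_op i e F t = e \<circ> interior_op F t \<circ> i"

definition min_elems :: "'a::order set \<Rightarrow> 'a set" where
  "min_elems F = {m \<in> F. \<forall>x\<in>F. x \<le> m \<longrightarrow> x = m}"

end

theory Submission
  imports Defs
begin

text \<open>
  Each \<open>p\<^sub>t\<close> maps \<open>L\<^sup>t\<close> into \<open>F\<close>, which gives one inclusion. Conversely, for \<open>q \<in> F\<close> and any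
  \<open>m \<in> F\<close> below \<open>q\<close> (in particular a minimal one), \<open>e q\<close> is a fixed point of \<open>h\<^sub>m\<close>: from
  \<open>q \<le> p\<^sub>m (i (e q)) \<le> i (e q)\<close> one gets \<open>e q = e (p\<^sub>m (i (e q)))\<close>, since \<open>e \<circ> i \<circ> e = e\<close>.
\<close>

lemma Sup_fin_mem_closed:
  fixes S :: "'a::semilattice_sup set"
  assumes "finite A" "A \<noteq> {}" "A \<subseteq> S"
    and "\<And>x y. x \<in> S \<Longrightarrow> y \<in> S \<Longrightarrow> sup x y \<in> S"
  shows "\<Squnion>\<^sub>f\<^sub>i\<^sub>n A \<in> S"
  using assms by (induction A rule: finite_ne_induct) auto

text \<open>\<open>isLub\<close> with carrier \<open>F \<inter> {t..}\<close> includes membership in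
  that carrier, so the join of the ambient lattice cannot leave it.\<close>

lemma subconfluence_sup_closed:
  assumes "subconfluence F" "t \<in> F" "x \<in> F \<inter> {t..}" "y \<in> F \<inter> {t..}"
  shows "sup x y \<in> F \<inter> {t..}"
  proof -
  have "isLub (F \<inter> {t..}) {x, y} (sup x y)"
    using assms unfolding subconfluence_def by blast
  then show ?thesis
    by (rule isLubD1a)
qed

text \<open>The joined set contains \<open>t\<close>, hence is nonempty, and closure under binary
  joins extends to finite ones.\<close>

lemma interior_op_mem:
  fixes F :: "'a::{finite,lattice} set"
  assumes "subconfluence F" "t \<in> F" "t \<le> x"
  shows "interior_op F t x \<in> F"
proof -
  have "interior_op F t x \<in> F \<inter> {t..}"
    unfolding interior_op_def
    using assms subconfluence_sup_closed[OF assms(1,2)]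
    by (intro Sup_fin_mem_closed) auto
  then show ?thesis by blast
qed

lemma interior_op_le:
  fixes F :: "'a::{finite,lattice} set"
  assumes "t \<in> F" "t \<le> x"
  shows "interior_op F t x \<le> x"
  unfolding interior_op_def using assms by (intro Sup_fin.boundedI) auto

lemma le_interior_op:
  fixes F :: "'a::{finite,lattice} set"
  assumes "q \<in> F" "t \<le> q" "q \<le> x"
  shows "q \<le> interior_op F t x"
  unfolding interior_op_def using assms by (intro Sup_fin.coboundedI) auto

text \<open>Ensures that \<open>i\<close> sends the domain of \<open>h_op i e F t\<close> into
  \<open>{t..}\<close>, where \<open>interior_op F t\<close> is meaningful.\<close>

lemma galois_connection_le_swap:
  assumes "galois_connection i e" "x \<le> e l"
  shows "l \<le> i x"
proof -
  have "l \<le> i (e l)" and "antimono i"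
    using assms(1) unfolding galois_connection_def by blast+
  then show ?thesis
    using antimonoD[OF _ assms(2)] order_trans by blast
qed

lemma h_op_mem_image:
  fixes F :: "'l::{finite,lattice} set"
  assumes "galois_connection i e" "subconfluence F" "t \<in> F" "x \<le> e t"
  shows "h_op i e F t x \<in> e ` F"
  using interior_op_mem[OF assms(2,3) galois_connection_le_swap[OF assms(1,4)]]
  by (simp add: h_op_def)

lemma h_op_fixes:
  fixes F :: "'l::{finite,lattice} set"
  assumes gc: "galois_connection i e" and F: "t \<in> F" "q \<in> F" "t \<le> q"
  shows "h_op i e F t (e q) = e q"
proof -
  let ?p = "interior_op F t (i (e q))"
  have e: "antimono e" and closure: "e q \<le> e (i (e q))" "q \<le> i (e q)"
    using gc unfolding galois_connection_def by blast+
  have "e ?p \<le> e q"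
    using antimonoD[OF e le_interior_op] F closure by blast
  \<comment> \<open>Applying \<open>e\<close> to \<open>?p \<le> i (e q)\<close> gives
    \<open>e (i (e q)) \<le> e ?p\<close>, and \<open>e q\<close> lies below the left side.\<close>
  moreover have "e q \<le> e ?p"
    using antimonoD[OF e interior_op_le] F closure by (meson order_trans)
  ultimately show ?thesis
    by (simp add: h_op_def)
qed

lemma ex_min_elems_le:
  assumes "finite F" "q \<in> F"
  shows "\<exists>m\<in>min_elems F. m \<le> q"
  using finite_has_minimal2[OF assms] unfolding min_elems_def by blast

theorem theorem3:
  fixes i :: "'x::{finite,lattice} \<Rightarrow> 'l::{finite,lattice}"
    and e :: "'l \<Rightarrow> 'x"
    and F :: "'l set"
  assumes "galois_connection i e"
    and "subconfluence F"
  shows "e ` F = (\<Union>t\<in>F. h_op i e F t ` {..e t}) \<and>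
    (\<Union>t\<in>F. h_op i e F t ` {..e t}) = (\<Union>m\<in>min_elems F. h_op i e F m ` {..e m})"
proof -
  have "e q \<in> (\<Union>m\<in>min_elems F. h_op i e F m ` {..e m})" if q: "q \<in> F" for q
  proof -
    obtain m where m: "m \<in> min_elems F" "m \<le> q"
      using ex_min_elems_le[of F q] q by auto
    have "m \<in> F"
      using m(1) by (simp add: min_elems_def)
    then have "h_op i e F m (e q) = e q"
      using h_op_fixes assms(1) q m(2) by blast
    \<comment> \<open>The fixed point \<open>e q\<close> serves as its own preimage, so it must lie
      in the domain \<open>{..e m}\<close>.\<close>
    moreover have "e q \<le> e m"
      using assms(1) m(2) unfolding galois_connection_def by (blast dest: antimonoD)
    ultimately show ?thesis
      using m(1) by (metis UN_I atMost_iff image_eqI)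
  qed
  then have "e ` F \<subseteq> (\<Union>m\<in>min_elems F. h_op i e F m ` {..e m})"
    by blast
  moreover have "(\<Union>m\<in>min_elems F. h_op i e F m ` {..e m}) \<subseteq> (\<Union>t\<in>F. h_op i e F t ` {..e t})"
    unfolding min_elems_def by blast
  moreover have "(\<Union>t\<in>F. h_op i e F t ` {..e t}) \<subseteq> e ` F"
    using h_op_mem_image[OF assms] by blast
  \<comment> \<open>The three inclusions form a cycle, so all three sets coincide.\<close>
  ultimately show ?thesis
    by (intro conjI equalityI) (rule order_trans; assumption | assumption)+
qed

end
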